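(* Let $G(L)=(V,E,L)$ be a temporal graph or temporal digraph on $n$ vertices, let $S(L)$ be the set of all its time edges (resp. time arcs), and let $s\in V$ be a source vertex. Run the Foremost Journey Algorithm (described in the context) on input $(G(L),s)$. Then, for every vertex $v\in V$, $v\neq s$, the following hold: (a) If at termination $arrival\_time[v]<+\infty$, then there exists a foremost journey from $s$ to $v$, the arrival time of which is exactly $arrival\_time[v]$; this journey can be constructed by following the $parent$ pointers from $v$ in reverse order. (b) If at termination $arrival\_time[v]=+\infty$, then no $(s,v)$-journey exists in $G(L)$. (c) The time complexity of the algorithm is dominated by the time for sorting the set $S(L)$ of time edges (resp. time arcs) by their labels.
   Context: A temporal (di)graph is a triple $G(L)=(V,E,L)$ where $(V,E)$ is a finite (di)graph and $L=\{L_e\subseteq\mathbb{N}^*: e\in E\}$ assigns to each edge (arc) a (finite) set of positive integer labels. A time edge is a triple $(u,v,l)$ where $e=\{u,v\}$ (resp. $e=(u,v)$) is an edge (resp. arc) and $l\in L_e$; an undirected edge $\{u,v\}$ yields both $(u,v,l)$ and $(v,u,l)$ for every $l\in L_e$. A $(u,v)$-journey is a sequence of time edges $(u,u_1,l_1),(u_1,u_2,l_2),\ldots,(u_{k-1},v,l_k)$ with $l_i<l_{i+1}$ for all $1\le i\le k-1$; its arrival time is $l_k$. A $(u,v)$-journey is foremost if its arrival time is minimum among all $(u,v)$-journeys. Foremost Journey Algorithm (input: $G(L)$, $s$): 1. Sort $S(L)$ in increasing order of labels; let $S'$ be the sorted array. 2. Set $R:=\{s\}$, $arrival\_time[s]:=0$,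 and for all $v\in V\setminus\{s\}$ set $parent[v]:=\emptyset$, $arrival\_time[v]:=+\infty$. 3. For all time edges (arcs) $(a,b,l)$ in the order given by $S'$: if $a\in R$ and $b\notin R$ and $arrival\_time[a]<l$, then set $parent[b]:=a$, $arrival\_time[b]:=l$, $R:=R\cup\{b\}$.
   Formalization: In (c) the running time is bounded by a constant times the sorting time plus the number of vertices with no incident time edge, since initialisation visits those too and (c) fails without the term (e.g. no time edges); the constant is stated per type of vertices. *)

theory Defs
  imports Main "HOL-Library.Extended_Nat" "HOL-Library.Multiset"
begin

text \<open>The labelling is a total function; only its values on edges (arcs) are relevant.\<close>

datatype 'v temporal_graph =
    Undirected "'v set" "'v set set" "'v set \<Rightarrow> nat set"
  | Directed "'v set" "('v \<times> 'v) set" "'v \<times> 'v \<Rightarrow> nat set"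

type_synonym 'v time_edge = "'v \<times> 'v \<times> nat"

fun label :: "'v time_edge \<Rightarrow> nat" where
  "label (u, v, l) = l"

fun verts :: "'v temporal_graph \<Rightarrow> 'v set" where
  "verts (Undirected V E L) = V"
| "verts (Directed V E L) = V"

text \<open>Loops are not excluded, so graphs and digraphs with or without loops are both covered.\<close>

fun wf_temporal_graph :: "'v temporal_graph \<Rightarrow> bool" where
  "wf_temporal_graph (Undirected V E L) \<longleftrightarrow>
     finite V \<and> E \<subseteq> {{u, v} | u v. u \<in> V \<and> v \<in> V} \<and> (\<forall>e\<in>E. finite (L e) \<and> 0 \<notin> L e)"
| "wf_temporal_graph (Directed V E L) \<longleftrightarrow>
     finite V \<and> E \<subseteq> V \<times> V \<and> (\<forall>e\<in>E. finite (L e) \<and> 0 \<notin> L e)"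

fun time_edges :: "'v temporal_graph \<Rightarrow> 'v time_edge set" where
  "time_edges (Undirected V E L) = {(u, v, l). {u, v} \<in> E \<and> l \<in> L {u, v}}"
| "time_edges (Directed V E L) = {(u, v, l). (u, v) \<in> E \<and> l \<in> L (u, v)}"

fun consecutive :: "'v time_edge \<Rightarrow> 'v time_edge \<Rightarrow> bool" where
  "consecutive (a, b, l) (c, d, m) \<longleftrightarrow> b = c \<and> l < m"

definition journey :: "'v temporal_graph \<Rightarrow> 'v \<Rightarrow> 'v \<Rightarrow> 'v time_edge list \<Rightarrow> bool" where
  "journey G u v J \<longleftrightarrow>
     J \<noteq> [] \<and> set J \<subseteq> time_edges G \<and> successively consecutive J \<and>
     fst (hd J) = u \<and> fst (snd (last J)) = v"

definition arrival :: "'v time_edge list \<Rightarrow> nat" where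
  "arrival J = label (last J)"

definition foremost :: "'v temporal_graph \<Rightarrow> 'v \<Rightarrow> 'v \<Rightarrow> 'v time_edge list \<Rightarrow> bool" where
  "foremost G u v J \<longleftrightarrow>
     journey G u v J \<and> (\<forall>J'. journey G u v J' \<longrightarrow> arrival J \<le> arrival J')"

text \<open>Vertices without incident time edges contribute nothing to the array to be sorted, but the
  initialisation of the algorithm still visits them, so they enter its running time separately.\<close>

definition isolated :: "'v temporal_graph \<Rightarrow> 'v set" where
  "isolated G = {v \<in> verts G. \<forall>(a, b, l) \<in> time_edges G. v \<noteq> a \<and> v \<noteq> b}"

text \<open>A command maps a memory state to the resulting state and the number of elementary steps
  performed. Assignments, tests, and advancing a loop to its next element cost one step each.\<close>

type_synonym 's cmd = "'s \<Rightarrow> 's \<times> nat"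

definition assign :: "('s \<Rightarrow> 's) \<Rightarrow> 's cmd" where
  "assign f = (\<lambda>\<sigma>. (f \<sigma>, 1))"

definition seq_cmd :: "'s cmd \<Rightarrow> 's cmd \<Rightarrow> 's cmd"  (infixr ";;" 60) where
  "c ;; d = (\<lambda>\<sigma>. let (\<sigma>1, t1) = c \<sigma>; (\<sigma>2, t2) = d \<sigma>1 in (\<sigma>2, t1 + t2))"

definition when_cmd :: "('s \<Rightarrow> bool) \<Rightarrow> 's cmd \<Rightarrow> 's cmd" where
  "when_cmd P c = (\<lambda>\<sigma>. if P \<sigma> then (let (\<sigma>', t) = c \<sigma> in (\<sigma>', 1 + t)) else (\<sigma>, 1))"

fun for_each :: "'x list \<Rightarrow> ('x \<Rightarrow> 's cmd) \<Rightarrow> 's cmd" where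
  "for_each [] c = (\<lambda>\<sigma>. (\<sigma>, 0))"
| "for_each (x # xs) c = assign (\<lambda>\<sigma>. \<sigma>) ;; c x ;; for_each xs c"

text \<open>The sorting method is left open: a sorting procedure is any routine that accesses its input
  array by reading one entry at a time. Reading an entry costs one step, and a \<open>Step\<close> node
  stands for any other elementary operation (a comparison, a write, ...). Every correct
  sorting procedure must then read each entry, whatever method it uses. A procedure is a family of
  routines, one for each length of the input array.\<close>

datatype 'e routine =
    Return "'e list"
  | Read nat "'e \<Rightarrow> 'e routine"
  | Step "'e routine"

primrec run :: "'e routine \<Rightarrow> 'e list \<Rightarrow> 'e list \<times> nat" where
  "run (Return ys) xs = (ys, 0)"
| "run (Read i k) xs = (let (ys, t) = run (k (xs ! i)) xs in (ys, 1 + t))"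
| "run (Step r) xs = (let (ys, t) = run r xs in (ys, 1 + t))"

definition sorts_by :: "('e \<Rightarrow> nat) \<Rightarrow> (nat \<Rightarrow> 'e routine) \<Rightarrow> bool" where
  "sorts_by key A \<longleftrightarrow>
     (\<forall>xs. let ys = fst (run (A (length xs)) xs)
           in mset ys = mset xs \<and> sorted (map key ys))"

definition sorted_array :: "(nat \<Rightarrow> 'e routine) \<Rightarrow> 'e list \<Rightarrow> 'e list" where
  "sorted_array A xs = fst (run (A (length xs)) xs)"

definition sorting_time :: "(nat \<Rightarrow> 'e routine) \<Rightarrow> 'e list \<Rightarrow> nat" where
  "sorting_time A xs = snd (run (A (length xs)) xs)"

record 'v memory =
  reached :: "'v set"
  parent :: "'v \<Rightarrow> 'v option"
  arrival_time :: "'v \<Rightarrow> enat"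

definition initialise :: "'v list \<Rightarrow> 'v \<Rightarrow> 'v memory cmd" where
  "initialise vs s =
     assign (\<lambda>\<sigma>. \<sigma>\<lparr>reached := {s}\<rparr>) ;;
     assign (\<lambda>\<sigma>. \<sigma>\<lparr>arrival_time := (arrival_time \<sigma>)(s := 0)\<rparr>) ;;
     for_each vs (\<lambda>v. when_cmd (\<lambda>\<sigma>. v \<noteq> s)
       (assign (\<lambda>\<sigma>. \<sigma>\<lparr>parent := (parent \<sigma>)(v := None)\<rparr>) ;;
        assign (\<lambda>\<sigma>. \<sigma>\<lparr>arrival_time := (arrival_time \<sigma>)(v := \<infinity>)\<rparr>)))"

fun process :: "'v time_edge \<Rightarrow> 'v memory cmd" where
  "process (a, b, l) =
     when_cmd (\<lambda>\<sigma>. a \<in> reached \<sigma>)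
      (when_cmd (\<lambda>\<sigma>. b \<notin> reached \<sigma>)
        (when_cmd (\<lambda>\<sigma>. arrival_time \<sigma> a < enat l)
          (assign (\<lambda>\<sigma>. \<sigma>\<lparr>parent := (parent \<sigma>)(b := Some a)\<rparr>) ;;
           assign (\<lambda>\<sigma>. \<sigma>\<lparr>arrival_time := (arrival_time \<sigma>)(b := enat l)\<rparr>) ;;
           assign (\<lambda>\<sigma>. \<sigma>\<lparr>reached := insert b (reached \<sigma>)\<rparr>))))"

definition foremost_journey_algorithm ::
    "(nat \<Rightarrow> 'v time_edge routine) \<Rightarrow> 'v list \<Rightarrow> 'v time_edge list \<Rightarrow> 'v \<Rightarrow> 'v memory cmd" where
  "foremost_journey_algorithm A vs S s =
     (\<lambda>\<sigma>. (\<sigma>, sorting_time A S)) ;; initialise vs s ;; for_each (sorted_array A S) process"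

text \<open>The algorithm receives the vertices and the time edges as arrays, each in an arbitrary order.\<close>

definition represents ::
    "'v list \<Rightarrow> 'v time_edge list \<Rightarrow> 'v temporal_graph \<Rightarrow> bool" where
  "represents vs S G \<longleftrightarrow>
     distinct vs \<and> set vs = verts G \<and> distinct S \<and> set S = time_edges G"

text \<open>\<open>traced \<sigma> s v J\<close>: following the parent pointers from \<open>v\<close> ends in \<open>s\<close>, and \<open>J\<close> is the
  sequence of time edges met on the way, reversed. The pointer from \<open>b\<close> to \<open>a\<close> stands for the time
  edge from \<open>a\<close> to \<open>b\<close> whose label is the recorded arrival time of \<open>b\<close>.\<close>

inductive traced :: "'v memory \<Rightarrow> 'v \<Rightarrow> 'v \<Rightarrow> 'v time_edge list \<Rightarrow> bool"
  for \<sigma> :: "'v memory" and s :: 'v where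
  "traced \<sigma> s s []"
| "\<lbrakk>b \<noteq> s; parent \<sigma> b = Some a; arrival_time \<sigma> b = enat l; traced \<sigma> s a J\<rbrakk>
     \<Longrightarrow> traced \<sigma> s b (J @ [(a, b, l)])"

end

theory Submission
  imports Defs
begin

text \<open>Since time edges are scanned by increasing label, the arrival time recorded when a vertex is
  reached never exceeds a label still to come. Hence after scanning a set \<open>D\<close> of time edges the
  recorded times are closed under relaxation along \<open>D\<close>: no edge of \<open>D\<close> that can be taken in time
  leads anywhere earlier than recorded. At termination this bounds every journey from below, while
  the parent pointers, whose recorded times strictly decrease, spell out a journey attaining the
  bound.

  For the running time, a correct sorting routine has to read every entry: otherwise changing an
  unread entry would leave its output, hence the multiset of its input, unchanged. So sorting takes
  at least one step per time edge, and every vertex that is not isolated is an endpoint of one.\<close>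

section \<open>Effect and cost of loops, of the initialisation and of processing one time
  edge\<close>

lemma fst_for_each: "fst (for_each xs c \<sigma>) = fold (\<lambda>x \<sigma>. fst (c x \<sigma>)) xs \<sigma>"
  by (induction xs arbitrary: \<sigma>)
    (auto simp: seq_cmd_def assign_def split_def Let_def)

text \<open>The \<open>Suc\<close> accounts for the step that advances the loop, charged once per
  element.\<close>

lemma snd_for_each_le:
  assumes "\<And>x \<sigma>. snd (c x \<sigma>) \<le> k"
  shows "snd (for_each xs c \<sigma>) \<le> length xs * Suc k"
proof (induction xs arbitrary: \<sigma>)
  case (Cons x xs)
  show ?case
    using add_mono[OF assms[of x \<sigma>] Cons.IH[of "fst (c x \<sigma>)"]]
    by (simp add: seq_cmd_def assign_def split_def Let_def)
qed simp

lemma fst_process: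
  "fst (process (a, b, l) \<sigma>) =
     (if a \<in> reached \<sigma> \<and> b \<notin> reached \<sigma> \<and> arrival_time \<sigma> a < enat l
      then \<sigma>\<lparr>parent := (parent \<sigma>)(b := Some a),
             arrival_time := (arrival_time \<sigma>)(b := enat l),
             reached := insert b (reached \<sigma>)\<rparr>
      else \<sigma>)"
  by (auto simp: when_cmd_def seq_cmd_def assign_def)

text \<open>In the worst case all three nested tests succeed and three assignments follow.\<close>

lemma snd_process_le: "snd (process e \<sigma>) \<le> 6"
  by (cases e) (auto simp: when_cmd_def seq_cmd_def assign_def)

text \<open>Names the loop body of \<open>initialise\<close>, so that its effect and cost can be
  stated once and the general loop lemmas apply to it.\<close>

definition reset_vertex :: "'v \<Rightarrow> 'v \<Rightarrow> 'v memory cmd" where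
  "reset_vertex s = (\<lambda>v. when_cmd (\<lambda>\<sigma>. v \<noteq> s)
     (assign (\<lambda>\<sigma>. \<sigma>\<lparr>parent := (parent \<sigma>)(v := None)\<rparr>) ;;
      assign (\<lambda>\<sigma>. \<sigma>\<lparr>arrival_time := (arrival_time \<sigma>)(v := \<infinity>)\<rparr>)))"

lemma fst_reset_vertex:
  "fst (reset_vertex s v \<sigma>) =
     (if v = s then \<sigma>
      else \<sigma>\<lparr>parent := (parent \<sigma>)(v := None), arrival_time := (arrival_time \<sigma>)(v := \<infinity>)\<rparr>)"
  by (simp add: reset_vertex_def when_cmd_def seq_cmd_def assign_def)

lemma snd_reset_vertex_le: "snd (reset_vertex s v \<sigma>) \<le> 3"
  by (simp add: reset_vertex_def when_cmd_def seq_cmd_def assign_def)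

lemma fold_reset_vertex:
  "reached (fold (\<lambda>v \<sigma>. fst (reset_vertex s v \<sigma>)) vs \<sigma>) = reached \<sigma>"
  "arrival_time (fold (\<lambda>v \<sigma>. fst (reset_vertex s v \<sigma>)) vs \<sigma>) v =
     (if v \<in> set vs - {s} then \<infinity> else arrival_time \<sigma> v)"
  by (induction vs arbitrary: \<sigma>) (auto simp: fst_reset_vertex)

lemma initialise_eq:
  "initialise vs s \<sigma> =
     (let (\<tau>, t) = for_each vs (reset_vertex s)
        (\<sigma>\<lparr>reached := {s}, arrival_time := (arrival_time \<sigma>)(s := 0)\<rparr>) in (\<tau>, 2 + t))"
  unfolding initialise_def reset_vertex_def[symmetric]
  by (simp add: seq_cmd_def assign_def split_def Let_def)

lemma fst_initialise:
  "reached (fst (initialise vs s \<sigma>)) = {s}"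
  "arrival_time (fst (initialise vs s \<sigma>)) s = 0"
  "v \<in> set vs - {s} \<Longrightarrow> arrival_time (fst (initialise vs s \<sigma>)) v = \<infinity>"
  by (simp_all add: initialise_eq split_def Let_def fst_for_each fold_reset_vertex)

lemma snd_initialise_le: "snd (initialise vs s \<sigma>) \<le> 2 + 4 * length vs"
  using snd_for_each_le[of "reset_vertex s" 3, OF snd_reset_vertex_le]
  by (simp add: initialise_eq split_def Let_def mult.commute)

section \<open>The loop invariant\<close>

text \<open>\<open>D\<close> collects the time edges processed so far. Reachability is tied to
  finite arrival times on \<open>V\<close> only, since the initial memory is arbitrary and the
  algorithm resets only the listed vertices.\<close>

definition scanned :: "'v set \<Rightarrow> 'v \<Rightarrow> 'v time_edge set \<Rightarrow> 'v memory \<Rightarrow> bool" where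
  "scanned V s D \<sigma> \<longleftrightarrow>
     s \<in> reached \<sigma> \<and> arrival_time \<sigma> s = 0 \<and>
     (\<forall>v\<in>V. v \<in> reached \<sigma> \<longleftrightarrow> arrival_time \<sigma> v \<noteq> \<infinity>) \<and>
     (\<forall>v\<in>reached \<sigma> - {s}. \<exists>a l. parent \<sigma> v = Some a \<and> arrival_time \<sigma> v = enat l \<and>
        (a, v, l) \<in> D \<and> a \<in> reached \<sigma> \<and> arrival_time \<sigma> a < enat l) \<and>
     (\<forall>(a, b, l)\<in>D. arrival_time \<sigma> a < enat l \<longrightarrow> arrival_time \<sigma> b \<le> enat l)"

text \<open>If \<open>b\<close> receives time \<open>l\<close>, an edge of \<open>D\<close> leaving
  \<open>b\<close> could be taken in time only with a label above \<open>l\<close>, and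
  \<open>D\<close> has none. So the new value triggers no further relaxation along
  \<open>D\<close>.\<close>

lemma scanned_process:
  assumes sc: "scanned V s D \<sigma>" and V: "a \<in> V" "b \<in> V"
    and le: "\<And>e. e \<in> D \<Longrightarrow> label e \<le> l"
  shows "scanned V s (insert (a, b, l) D) (fst (process (a, b, l) \<sigma>))"
proof -
  have s: "s \<in> reached \<sigma>" "arrival_time \<sigma> s = 0"
    and fin: "\<And>v. v \<in> V \<Longrightarrow> v \<in> reached \<sigma> \<longleftrightarrow> arrival_time \<sigma> v \<noteq> \<infinity>"
    and par: "\<And>v. v \<in> reached \<sigma> \<Longrightarrow> v \<noteq> s \<Longrightarrow> \<exists>a l. parent \<sigma> v = Some a \<and>
        arrival_time \<sigma> v = enat l \<and> (a, v, l) \<in> D \<and> a \<in> reached \<sigma> \<and> arrival_time \<sigma> a < enat l"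
    and relax: "\<And>a b l. (a, b, l) \<in> D \<Longrightarrow> arrival_time \<sigma> a < enat l \<Longrightarrow>
        arrival_time \<sigma> b \<le> enat l"
    using sc unfolding scanned_def by auto
  \<comment> \<open>The recorded time of a reached vertex other than \<open>s\<close> is the label
    of an edge in \<open>D\<close>, hence at most \<open>l\<close>.\<close>
  have early: "arrival_time \<sigma> v \<le> enat l" if "v \<in> reached \<sigma>" for v
  proof (cases "v = s")
    case False
    then show ?thesis using par[OF that] le by fastforce
  qed (simp add: s)
  show ?thesis
  proof (cases "a \<in> reached \<sigma> \<and> b \<notin> reached \<sigma> \<and> arrival_time \<sigma> a < enat l")
    case True
    let ?\<tau> = "\<sigma>\<lparr>parent := (parent \<sigma>)(b := Some a),
             arrival_time := (arrival_time \<sigma>)(b := enat l),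
             reached := insert b (reached \<sigma>)\<rparr>"
    have inf: "arrival_time \<sigma> b = \<infinity>" and bs: "b \<noteq> s" and ab: "a \<noteq> b"
      using True fin V s by auto
    have r: "arrival_time ?\<tau> d \<le> enat m"
      if e: "(c, d, m) \<in> insert (a, b, l) D" and lt: "arrival_time ?\<tau> c < enat m" for c d m
    proof (cases "(c, d, m) = (a, b, l)")
      case False
      then have D: "(c, d, m) \<in> D" using e by blast
      then have "m \<le> l" using le by force
      then have "c \<noteq> b" using lt by auto
      then have "arrival_time \<sigma> d \<le> enat m" using relax[OF D] lt by simp
      \<comment> \<open>The old time of \<open>d\<close> is finite while that of \<open>b\<close>
        was infinite, so \<open>d\<close> differs from \<open>b\<close> and kept its time.\<close>
      then show ?thesis using inf by auto
    qed auto
    have p: "\<exists>c m. parent ?\<tau> v = Some c \<and> arrival_time ?\<tau> v = enat m \<and>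
        (c, v, m) \<in> insert (a, b, l) D \<and> c \<in> reached ?\<tau> \<and> arrival_time ?\<tau> c < enat m"
      if v: "v \<in> reached ?\<tau>" "v \<noteq> s" for v
    proof (cases "v = b")
      case True
      then show ?thesis using \<open>a \<in> reached \<sigma> \<and> _\<close> ab by simp
    next
      case False
      then obtain c m where "parent \<sigma> v = Some c" "arrival_time \<sigma> v = enat m"
        "(c, v, m) \<in> D" "c \<in> reached \<sigma>" "arrival_time \<sigma> c < enat m"
        using par[of v] v False by auto
      moreover have "c \<noteq> b" using \<open>c \<in> reached \<sigma>\<close> True by auto
      ultimately show ?thesis using False by auto
    qed
    have "scanned V s (insert (a, b, l) D) ?\<tau>"
      unfolding scanned_def
    proof (intro conjI)
      show "\<forall>(c, d, m)\<in>insert (a, b, l) D.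
          arrival_time ?\<tau> c < enat m \<longrightarrow> arrival_time ?\<tau> d \<le> enat m"
        using r by blast
      show "\<forall>v\<in>V. v \<in> reached ?\<tau> \<longleftrightarrow> arrival_time ?\<tau> v \<noteq> \<infinity>"
        using fin by simp
    qed (use p s bs in \<open>blast | simp\<close>)+
    then show ?thesis unfolding fst_process if_P[OF True] .
  next
    case False
    \<comment> \<open>A finite time at \<open>a\<close> means that \<open>a\<close> is reached; as
      the guard failed, \<open>b\<close> must be reached already, and \<open>early\<close>
      applies.\<close>
    have "arrival_time \<sigma> b \<le> enat l" if "arrival_time \<sigma> a < enat l"
      using False that early fin V by auto
    then have "scanned V s (insert (a, b, l) D) \<sigma>"
      using sc unfolding scanned_def by blast
    then show ?thesis unfolding fst_process if_not_P[OF False] .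
  qed
qed

text \<open>The invariant is carried along the sorted list; the third assumption says that the edges
  in \<open>D\<close> came before those of \<open>es\<close> in label order, and sortedness
  preserves this as \<open>D\<close> grows.\<close>

lemma scanned_fold_process:
  assumes "scanned V s D \<sigma>" "sorted (map label es)"
    and "\<And>e e'. e \<in> D \<Longrightarrow> e' \<in> set es \<Longrightarrow> label e \<le> label e'"
    and "\<And>a b l. (a, b, l) \<in> set es \<Longrightarrow> a \<in> V \<and> b \<in> V"
  shows "scanned V s (D \<union> set es) (fold (\<lambda>e \<sigma>. fst (process e \<sigma>)) es \<sigma>)"
  using assms
proof (induction es arbitrary: D \<sigma>)
  case (Cons e es)
  obtain a b l where e: "e = (a, b, l)" by (cases e)
  have "scanned V s (insert e D) (fst (process e \<sigma>))"
    unfolding e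
    by (rule scanned_process) (use Cons.prems e in force)+
  then have "scanned V s (insert e D \<union> set es)
      (fold (\<lambda>e \<sigma>. fst (process e \<sigma>)) es (fst (process e \<sigma>)))"
  proof (rule Cons.IH)
    show "label e1 \<le> label e2" if "e1 \<in> insert e D" "e2 \<in> set es" for e1 e2
      using that Cons.prems(2) Cons.prems(3)[of e1 e2] by auto
    show "a \<in> V \<and> b \<in> V" if "(a, b, l) \<in> set es" for a b l
      using Cons.prems(4)[of a b l] that by simp
  qed (use Cons.prems(2) in simp)
  then show ?case by simp
qed simp

section \<open>Journeys compared with recorded arrival times\<close>

text \<open>Journeys are split at their last edge, which matches both reverse list induction and the
  way \<open>traced\<close> appends edges.\<close>

lemma journey_snoc:
  "journey G s v (J @ [(a, b, l)]) \<longleftrightarrow>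
     (a, b, l) \<in> time_edges G \<and> b = v \<and>
     (if J = [] then a = s else journey G s a J \<and> arrival J < l)"
proof (cases J rule: rev_cases)
  case (snoc J' e)
  then show ?thesis
    by (cases e) (auto simp: journey_def arrival_def successively_append_iff hd_append)
qed (auto simp: journey_def)

lemma time_edge_props:
  assumes "wf_temporal_graph G" "(a, b, l) \<in> time_edges G"
  shows "a \<in> verts G" "b \<in> verts G" "0 < l"
proof -
  show "a \<in> verts G" "b \<in> verts G"
    using assms by (cases G; fastforce simp: doubleton_eq_iff)+
  show "0 < l"
    using assms by (cases G) (auto intro!: gr0I)
qed

text \<open>Induction along the journey: the recorded time of the tail of its last edge is below the
  label of that edge, so the relaxation clause, now valid for all time edges, bounds the time of the
  head.\<close>

lemma arrival_time_le_arrival: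
  assumes "wf_temporal_graph G" "scanned V s (time_edges G) \<sigma>" "journey G s v J"
  shows "arrival_time \<sigma> v \<le> enat (arrival J)"
  using assms(3)
proof (induction J arbitrary: v rule: rev_induct)
  case Nil
  then show ?case by (simp add: journey_def)
next
  case (snoc e J)
  obtain a b l where e: "e = (a, b, l)" by (cases e)
  have j: "(a, v, l) \<in> time_edges G" "if J = [] then a = s else journey G s a J \<and> arrival J < l"
    using snoc.prems unfolding e journey_snoc by auto
  have "arrival_time \<sigma> a < enat l"
  proof (cases "J = []")
    case True
    \<comment> \<open>A first edge leaves \<open>s\<close>, whose time is 0, and labels are
      positive.\<close>
    then show ?thesis
      using j assms(2) time_edge_props(3)[OF assms(1) j(1)] by (simp add: scanned_def enat_0_iff zero_enat_def)
  next
    case False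
    then have "arrival_time \<sigma> a \<le> enat (arrival J)" "arrival J < l"
      using j snoc.IH by auto
    then show ?thesis using order_le_less_trans enat_ord_simps(2) by blast
  qed
  then have "arrival_time \<sigma> v \<le> enat l"
    using assms(2) j(1) unfolding scanned_def by blast
  then show ?case by (simp add: e arrival_def)
qed

text \<open>The induction is on the recorded arrival time, which is strictly smaller at the parent;
  this makes following the pointers terminate and the labels met increase.\<close>

lemma traced_journey_exists:
  assumes sc: "scanned V s (time_edges G) \<sigma>" and "v \<in> reached \<sigma>"
  shows "\<exists>J. traced \<sigma> s v J \<and>
    (if v = s then J = [] else journey G s v J \<and> enat (arrival J) = arrival_time \<sigma> v)"
  using assms(2)
proof (induction "arrival_time \<sigma> v" arbitrary: v rule: less_induct)
  case less
  show ?case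
  proof (cases "v = s")
    case True
    then show ?thesis using traced.intros(1) by auto
  next
    case False
    then obtain a l where p: "parent \<sigma> v = Some a" "arrival_time \<sigma> v = enat l"
      "(a, v, l) \<in> time_edges G" "a \<in> reached \<sigma>" "arrival_time \<sigma> a < enat l"
      using less.prems sc unfolding scanned_def by blast
    obtain J where J: "traced \<sigma> s a J"
      "if a = s then J = [] else journey G s a J \<and> enat (arrival J) = arrival_time \<sigma> a"
      using less.hyps[of a] p by auto
    have "traced \<sigma> s v (J @ [(a, v, l)])"
      using traced.intros(2)[OF False p(1,2) J(1)] .
    moreover have "journey G s v (J @ [(a, v, l)])"
    proof (cases "a = s")
      case True
      then show ?thesis using J(2) p(3) journey_snoc[of G s v "[]" a v l] by simp
    next
      case False
      then have "journey G s a J" "enat (arrival J) < enat l" using J(2) p(5) by auto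
      moreover from this have "J \<noteq> []" by (simp add: journey_def)
      ultimately show ?thesis using p(3) by (auto simp: journey_snoc)
    qed
    ultimately show ?thesis using False p(2) by (auto simp: arrival_def)
  qed
qed

section \<open>Lower bound for sorting and count of vertices\<close>

text \<open>A routine is a decision tree, so the positions depend on the input: they are those met
  on the branch that \<open>xs\<close> selects.\<close>

primrec positions_read :: "'e routine \<Rightarrow> 'e list \<Rightarrow> nat set" where
  "positions_read (Return ys) xs = {}"
| "positions_read (Read i k) xs = insert i (positions_read (k (xs ! i)) xs)"
| "positions_read (Step r) xs = positions_read r xs"

text \<open>Only an inequality, since repeated reads of one position and \<open>Step\<close> nodes
  cost time without adding a position.\<close>

lemma card_positions_read_le:
  "finite (positions_read r xs) \<and> card (positions_read r xs) \<le> snd (run r xs)"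
proof (induction r)
  case (Read i k)
  then show ?case
    using Read.IH[of "k (xs ! i)"] by (auto simp: split_def Let_def card_insert_if intro: le_SucI)
qed (auto simp: split_def Let_def)

text \<open>Changing an unread entry leaves every answer on the branch unchanged, so the same leaf
  is reached.\<close>

lemma run_update_unread:
  "i \<notin> positions_read r xs \<Longrightarrow> fst (run r (xs[i := x])) = fst (run r xs)"
  by (induction r) (auto simp: split_def Let_def)

text \<open>Two distinct elements are required to alter an entry: over a one-element type, a
  constant list could be returned without any reading.\<close>

lemma length_le_sorting_time:
  fixes key :: "'e \<Rightarrow> nat"
  assumes A: "sorts_by key A" and "\<exists>x y :: 'e. x \<noteq> y"
  shows "length xs \<le> sorting_time A xs"
proof -
  let ?r = "A (length xs)"
  have "i \<in> positions_read ?r xs" if i: "i < length xs" for i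
  proof (rule ccontr)
    assume "i \<notin> positions_read ?r xs"
    obtain x where x: "x \<noteq> xs ! i" using assms(2) by metis
    have out: "mset (fst (run (A (length zs)) zs)) = mset zs" for zs
      using A by (simp add: sorts_by_def Let_def)
    \<comment> \<open>The update keeps the length, so the same routine runs on both arrays and
      returns the same output.\<close>
    have "mset (xs[i := x]) = mset xs"
      using out[of xs] out[of "xs[i := x]"] run_update_unread[OF \<open>i \<notin> _\<close>] by simp
    then have "add_mset x (mset xs - {#xs ! i#}) = add_mset (xs ! i) (mset xs - {#xs ! i#})"
      using i by (simp add: mset_update)
    then show False using x by simp
  qed
  then have "{..<length xs} \<subseteq> positions_read ?r xs" by auto
  then have "length xs \<le> card (positions_read ?r xs)"
    using card_mono[of "positions_read ?r xs" "{..<length xs}"] card_positions_read_le[of ?r xs]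
    by simp
  then show ?thesis
    unfolding sorting_time_def using card_positions_read_le[of ?r xs] by linarith
qed

text \<open>Every vertex that is not isolated is the first or second component of some time edge,
  and each time edge covers at most two vertices.\<close>

lemma card_verts_le:
  assumes "wf_temporal_graph G" "finite (time_edges G)"
  shows "card (verts G) \<le> card (isolated G) + 2 * card (time_edges G)"
proof -
  let ?E = "time_edges G"
  have fin: "finite (isolated G)"
    using assms(1) by (cases G) (auto simp: isolated_def)
  have "verts G \<subseteq> isolated G \<union> (fst ` ?E \<union> (fst \<circ> snd) ` ?E)"
    by (force simp: isolated_def)
  then have "card (verts G) \<le> card (isolated G \<union> (fst ` ?E \<union> (fst \<circ> snd) ` ?E))"
    by (intro card_mono) (use assms(2) fin in auto)
  also have "\<dots> \<le> card (isolated G) + (card (fst ` ?E) + card ((fst \<circ> snd) ` ?E))"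
    using card_Un_le add_left_mono order_trans by meson
  also have "\<dots> \<le> card (isolated G) + (card ?E + card ?E)"
    by (intro add_mono card_image_le assms(2) order_refl)
  finally show ?thesis by simp
qed

section \<open>The whole algorithm: final invariant, running time and conclusion\<close>

lemma scanned_foremost_journey_algorithm:
  assumes wf: "wf_temporal_graph G" and rep: "represents vs S G" and A: "sorts_by label A"
  shows "scanned (verts G) s (time_edges G) (fst (foremost_journey_algorithm A vs S s \<sigma>\<^sub>0))"
proof -
  have V: "set vs = verts G" and S: "set S = time_edges G"
    using rep by (auto simp: represents_def)
  have "mset (sorted_array A S) = mset S" and sorted: "sorted (map label (sorted_array A S))"
    using A by (auto simp: sorts_by_def sorted_array_def Let_def)
  then have set: "set (sorted_array A S) = time_edges G"
    using S by (metis set_mset_mset)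
  let ?\<sigma> = "fst (initialise vs s \<sigma>\<^sub>0)"
  have "arrival_time ?\<sigma> v = (if v = s then 0 else \<infinity>)" if "v \<in> verts G" for v
    using that V by (simp add: fst_initialise)
  \<comment> \<open>Only \<open>s\<close> is reached and nothing is scanned, so the parent and
    relaxation clauses are vacuous.\<close>
  then have "scanned (verts G) s {} ?\<sigma>"
    by (simp add: scanned_def fst_initialise(1,2) del: not_infinity_eq)
  from scanned_fold_process[OF this sorted]
  have "scanned (verts G) s (time_edges G)
      (fold (\<lambda>e \<sigma>. fst (process e \<sigma>)) (sorted_array A S) ?\<sigma>)"
    using time_edge_props[OF wf] by (simp add: set)
  then show ?thesis
    by (simp add: foremost_journey_algorithm_def seq_cmd_def split_def Let_def fst_for_each)
qed

text \<open>The constants are two initial assignments, 3 + 1 steps per vertex and 6 + 1 per time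
  edge, the extra 1 being the loop advance.\<close>

lemma snd_foremost_journey_algorithm:
  fixes s :: 'v and \<sigma>\<^sub>0 :: "'v memory"
  assumes rep: "represents vs S G" and A: "sorts_by label A"
  defines "T \<equiv> snd (foremost_journey_algorithm A vs S s \<sigma>\<^sub>0)"
  shows "sorting_time A S \<le> T"
    and "T \<le> sorting_time A S + 2 + 4 * card (verts G) + 7 * card (time_edges G)"
proof -
  have "mset (sorted_array A S) = mset S"
    using A by (auto simp: sorts_by_def sorted_array_def Let_def)
  then have "length (sorted_array A S) = length S"
    by (metis size_mset)
  moreover have "length S = card (time_edges G)" "length vs = card (verts G)"
    using rep by (auto simp: represents_def simp flip: distinct_card)
  ultimately have len: "length (sorted_array A S) = card (time_edges G)"
    "length vs = card (verts G)" by auto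
  have T: "T = sorting_time A S + (snd (initialise vs s \<sigma>\<^sub>0) +
      snd (for_each (sorted_array A S) process (fst (initialise vs s \<sigma>\<^sub>0))))"
    by (simp add: T_def foremost_journey_algorithm_def seq_cmd_def split_def Let_def)
  show "sorting_time A S \<le> T"
    by (simp add: T)
  show "T \<le> sorting_time A S + 2 + 4 * card (verts G) + 7 * card (time_edges G)"
    using snd_initialise_le[of vs s \<sigma>\<^sub>0]
      snd_for_each_le[where c = process, OF snd_process_le, where xs = "sorted_array A S" and \<sigma> = "fst (initialise vs s \<sigma>\<^sub>0)"]
    unfolding T len by simp
qed

theorem theorem1:
  "\<exists>K::nat. \<forall>(G :: 'v temporal_graph) s vs S A \<sigma>\<^sub>0 \<sigma> T.
     wf_temporal_graph G \<and> s \<in> verts G \<and> represents vs S G \<and> sorts_by label A \<and>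
     foremost_journey_algorithm A vs S s \<sigma>\<^sub>0 = (\<sigma>, T) \<longrightarrow>
       (\<forall>v \<in> verts G - {s}.
          (arrival_time \<sigma> v < \<infinity> \<longrightarrow>
             (\<exists>J. foremost G s v J \<and> enat (arrival J) = arrival_time \<sigma> v \<and> traced \<sigma> s v J)) \<and>
          (arrival_time \<sigma> v = \<infinity> \<longrightarrow> \<not> (\<exists>J. journey G s v J))) \<and>
       sorting_time A S \<le> T \<and>
       T \<le> sorting_time A S + K * (card (time_edges G) + card (verts G)) \<and>
       T \<le> K * (sorting_time A S + card (isolated G))"
\<comment> \<open>With \<open>n\<close> vertices, \<open>m\<close> time edges and \<open>i\<close>
  isolated vertices, the cost beyond sorting is at most \<open>2 + 4 * n + 7 * m\<close>, and the 2
  is absorbed into \<open>2 * n\<close> as \<open>n\<close> is positive. Using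
  \<open>n \<le> i + 2 * m\<close> and that \<open>m\<close> is at most the sorting time, the total
  is at most 20 times the sorting time plus \<open>6 * i\<close>, which 22 covers.\<close>
proof (rule exI[of _ 22], intro allI impI, elim conjE)
  fix G :: "'v temporal_graph" and s vs S A \<sigma>\<^sub>0 \<sigma> T
  assume wf: "wf_temporal_graph G" and s: "s \<in> verts G" and rep: "represents vs S G"
    and A: "sorts_by label A" and alg: "foremost_journey_algorithm A vs S s \<sigma>\<^sub>0 = (\<sigma>, T)"
  let ?sort = "sorting_time A S" and ?m = "card (time_edges G)" and ?n = "card (verts G)"
    and ?i = "card (isolated G)"
  have sc: "scanned (verts G) s (time_edges G) \<sigma>"
    using scanned_foremost_journey_algorithm[OF wf rep A, of s \<sigma>\<^sub>0] alg by simp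
  have lower: "arrival_time \<sigma> v \<le> enat (arrival J)" if "journey G s v J" for v J
    using arrival_time_le_arrival[OF wf sc that] .
  have correct: "(arrival_time \<sigma> v < \<infinity> \<longrightarrow>
         (\<exists>J. foremost G s v J \<and> enat (arrival J) = arrival_time \<sigma> v \<and> traced \<sigma> s v J)) \<and>
      (arrival_time \<sigma> v = \<infinity> \<longrightarrow> \<not> (\<exists>J. journey G s v J))" if v: "v \<in> verts G - {s}" for v
  proof (intro conjI impI)
    assume "arrival_time \<sigma> v < \<infinity>"
    then have "v \<in> reached \<sigma>" using sc v by (auto simp: scanned_def)
    then obtain J where J: "traced \<sigma> s v J" "journey G s v J" "enat (arrival J) = arrival_time \<sigma> v"
      using traced_journey_exists[OF sc, of v] v by auto
    then have "foremost G s v J"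
      using lower by (auto simp: foremost_def simp flip: enat_ord_simps(1))
    then show "\<exists>J. foremost G s v J \<and> enat (arrival J) = arrival_time \<sigma> v \<and> traced \<sigma> s v J"
      using J by blast
  next
    assume "arrival_time \<sigma> v = \<infinity>"
    then show "\<not> (\<exists>J. journey G s v J)" using lower by fastforce
  qed
  have finV: "finite (verts G)" using wf by (cases G) auto
  have fin: "finite (time_edges G)" and m: "length S = ?m"
    using rep by (auto simp: represents_def simp flip: distinct_card) (metis List.finite_set)
  have T: "?sort \<le> T" "T \<le> ?sort + 2 + 4 * ?n + 7 * ?m"
    using snd_foremost_journey_algorithm[OF rep A, of s \<sigma>\<^sub>0] alg by auto
  have "?n > 0" using s finV by (auto simp: card_gt_0_iff)
  have "\<exists>x y :: 'v time_edge. x \<noteq> y"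
    \<comment> \<open>The two triples differ in the label, so this works even when \<open>s\<close>
      is the only element of the vertex type.\<close>
    by (rule exI[of _ "(s, s, 0)"], rule exI[of _ "(s, s, 1)"]) simp
  then have "?m \<le> ?sort"
    using length_le_sorting_time[OF A] m by metis
  then show "(\<forall>v \<in> verts G - {s}.
          (arrival_time \<sigma> v < \<infinity> \<longrightarrow>
             (\<exists>J. foremost G s v J \<and> enat (arrival J) = arrival_time \<sigma> v \<and> traced \<sigma> s v J)) \<and>
          (arrival_time \<sigma> v = \<infinity> \<longrightarrow> \<not> (\<exists>J. journey G s v J))) \<and>
       ?sort \<le> T \<and> T \<le> ?sort + 22 * (?m + ?n) \<and> T \<le> 22 * (?sort + ?i)"
    using correct T \<open>?n > 0\<close> card_verts_le[OF wf fin] by auto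
qed

end
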